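(* We have $$\liminf_{n\to\infty}\frac{S(n)}{\sqrt n}=\frac{\sqrt3}{3}\qquad\text{and}\qquad \limsup_{n\to\infty}\frac{S(n)}{\sqrt n}=\sqrt2 .$$
   Context: For an integer $n\ge 0$, let $\mathrm{inv}_2(n)$ denote the number of occurrences of $10$ as a scattered (not necessarily contiguous) subsequence of the binary representation of $n$ (most significant digit first), i.e. the number of pairs of digit positions with a $1$ to the left of a $0$; $\mathrm{inv}_2(0)=0$. Define $i_n=(-1)^{\mathrm{inv}_2(n)}$ and $S(N)=\sum_{0\le n\le N} i_n$ (both endpoints included). *)

theory Defs
  imports "HOL-Analysis.Analysis"
begin

(* bit n k is the coefficient of 2^k in the binary expansion of n, so the more significant
   digit, written further to the left, has the larger index.  Leading zeros contribute no
   pair, as no 1 stands to the left of them. *)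
definition inv2 :: "nat \<Rightarrow> nat" where
  "inv2 n = card {(j, k). k < j \<and> bit n j \<and> \<not> bit n k}"

lemma finite_inv2_pairs: "finite {(j, k). k < j \<and> bit (n::nat) j \<and> \<not> bit n k}"
proof (rule finite_subset)
  have "j < n" if "bit n j" for j
    using that by (metis bit_iff_odd div_less even_zero less_exp less_le_trans not_le)
  then show "{(j, k). k < j \<and> bit n j \<and> \<not> bit n k} \<subseteq> {..<n} \<times> {..<n}"
    by fastforce
qed simp

definition inv_sign :: "nat \<Rightarrow> int" where
  "inv_sign n = (-1) ^ inv2 n"

definition S :: "nat \<Rightarrow> int" where
  "S N = (\<Sum>n = 0..N. inv_sign n)"

end

theory Submission
  imports Defs "HOL-Real_Asymp.Real_Asymp"
begin

text \<open>
  Write \<open>i\<close> for the sign sequence and \<open>j\<close> for its product with the Thue--Morse sequence. Appending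
  a binary digit maps the pair \<open>(i, j)\<close> to \<open>(j, i)\<close> or \<open>(i, -j)\<close>, so the signs at
  \<open>4n, \<dots>, 4n + 3\<close> are \<open>i, j, -j, i\<close> and \<open>S (4n + 3) = 2 S n\<close>. Induction on the number of base-4
  digits gives \<open>(n + 1) / 3 \<le> (S n)\<^sup>2 \<le> 2 (n + 1)\<close>, where the two inequalities have to be
  sharpened for one value of \<open>(i, j)\<close> each. Equality holds on the left at
  \<open>n = 3 \<cdot> 4\<^sup>k - 1\<close> and on the right at \<open>n = 2 \<cdot> 4\<^sup>k - 1\<close>.
\<close>

section \<open>Signs under appending binary digits\<close>

definition weight :: "nat \<Rightarrow> nat" where
  "weight n = card {k. bit n k}"

text \<open>Appending a 0 multiplies \<open>inv_sign\<close> by the Thue-Morse sign, so this product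
  must be tracked as well for the recursion to close.\<close>

definition twisted_sign :: "nat \<Rightarrow> int" where
  "twisted_sign n = inv_sign n * (-1) ^ weight n"

lemma finite_bits: "finite {k. bit (n::nat) k}"
proof (rule finite_subset)
  show "{k. bit n k} \<subseteq> {..<n}"
    by (auto simp: bit_iff_odd) (metis div_less even_zero less_exp less_le_trans not_le)
qed simp

lemma weight_double: "weight (2 * n) = weight n"
proof -
  have "{k. bit (2 * n) k} = Suc ` {k. bit n k}"
  proof (intro set_eqI)
    fix k show "k \<in> {k. bit (2 * n) k} \<longleftrightarrow> k \<in> Suc ` {k. bit n k}"
      by (cases k) (auto simp: bit_0 bit_Suc)
  qed
  then show ?thesis
    by (simp add: weight_def card_image)
qed

lemma weight_double_Suc: "weight (2 * n + 1) = weight n + 1"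
proof -
  have "{k. bit (2 * n + 1) k} = insert 0 (Suc ` {k. bit n k})"
  proof (intro set_eqI)
    fix k show "k \<in> {k. bit (2 * n + 1) k} \<longleftrightarrow> k \<in> insert 0 (Suc ` {k. bit n k})"
      by (cases k) (auto simp: bit_0 bit_Suc)
  qed
  then show ?thesis
    by (simp add: weight_def card_image finite_bits)
qed

text \<open>Old pairs shift by one position (\<open>?A\<close>); the appended 0 makes one new pair
  with each 1 of \<open>n\<close> (\<open>?B\<close>).\<close>

lemma inv2_double: "inv2 (2 * n) = inv2 n + weight n"
proof -
  let ?A = "map_prod Suc Suc ` {(j, k). k < j \<and> bit n j \<and> \<not> bit n k}"
  let ?B = "(\<lambda>j. (Suc j, 0 :: nat)) ` {j. bit n j}"
  have "{(j, k). k < j \<and> bit (2 * n) j \<and> \<not> bit (2 * n) k} = ?A \<union> ?B"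
  proof (intro set_eqI)
    fix p :: "nat \<times> nat"
    obtain j k where p: "p = (j, k)" by (cases p)
    show "p \<in> {(j, k). k < j \<and> bit (2 * n) j \<and> \<not> bit (2 * n) k} \<longleftrightarrow> p \<in> ?A \<union> ?B"
      unfolding p by (cases j; cases k) (auto simp: bit_0 bit_Suc image_iff)
  qed
  moreover have "card (?A \<union> ?B) = card ?A + card ?B"
    by (rule card_Un_disjoint) (auto simp: finite_inv2_pairs finite_bits)
  moreover have "card ?A = inv2 n"
    unfolding inv2_def by (rule card_image) (auto simp: inj_on_def)
  moreover have "card ?B = weight n"
    unfolding weight_def by (rule card_image) (auto simp: inj_on_def)
  ultimately show ?thesis
    by (simp add: inv2_def)
qed

text \<open>The appended 1 has no digit to its right, so only the shifted old pairs remain.\<close>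

lemma inv2_double_Suc: "inv2 (2 * n + 1) = inv2 n"
proof -
  let ?A = "map_prod Suc Suc ` {(j, k). k < j \<and> bit n j \<and> \<not> bit n k}"
  have "{(j, k). k < j \<and> bit (2 * n + 1) j \<and> \<not> bit (2 * n + 1) k} = ?A"
  proof (intro set_eqI)
    fix p :: "nat \<times> nat"
    obtain j k where p: "p = (j, k)" by (cases p)
    show "p \<in> {(j, k). k < j \<and> bit (2 * n + 1) j \<and> \<not> bit (2 * n + 1) k} \<longleftrightarrow> p \<in> ?A"
      unfolding p by (cases j; cases k) (auto simp: bit_0 bit_Suc image_iff)
  qed
  moreover have "card ?A = inv2 n"
    unfolding inv2_def by (rule card_image) (auto simp: inj_on_def)
  ultimately show ?thesis
    by (simp add: inv2_def)
qed

lemma sign_double: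
  "inv_sign (2 * n) = twisted_sign n" "twisted_sign (2 * n) = inv_sign n"
  by (simp_all add: inv_sign_def twisted_sign_def inv2_double weight_double power_add
      flip: power_mult_distrib)

lemma sign_double_Suc:
  "inv_sign (2 * n + 1) = inv_sign n" "twisted_sign (2 * n + 1) = - twisted_sign n"
  unfolding inv_sign_def twisted_sign_def inv2_double_Suc weight_double_Suc by simp_all

lemma signs_quadruple:
  "inv_sign (4 * n) = inv_sign n" "twisted_sign (4 * n) = twisted_sign n"
  "inv_sign (4 * n + 1) = twisted_sign n" "twisted_sign (4 * n + 1) = - inv_sign n"
  "inv_sign (4 * n + 2) = - twisted_sign n" "twisted_sign (4 * n + 2) = inv_sign n"
  "inv_sign (4 * n + 3) = inv_sign n" "twisted_sign (4 * n + 3) = twisted_sign n"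
proof -
  have eqs: "4 * n = 2 * (2 * n)" "2 * (2 * n) + 2 = 2 * (2 * n + 1)"
    "2 * (2 * n) + 3 = 2 * (2 * n + 1) + 1"
    by simp_all
  show "inv_sign (4 * n) = inv_sign n" "twisted_sign (4 * n) = twisted_sign n"
    "inv_sign (4 * n + 1) = twisted_sign n" "twisted_sign (4 * n + 1) = - inv_sign n"
    "inv_sign (4 * n + 2) = - twisted_sign n" "twisted_sign (4 * n + 2) = inv_sign n"
    "inv_sign (4 * n + 3) = inv_sign n" "twisted_sign (4 * n + 3) = twisted_sign n"
    unfolding eqs sign_double sign_double_Suc by simp_all
qed

lemma inv_sign_0: "inv_sign 0 = 1" and twisted_sign_0: "twisted_sign 0 = 1"
  by (simp_all add: inv_sign_def twisted_sign_def inv2_def weight_def)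

lemma sign_cases: "inv_sign n = 1 \<or> inv_sign n = -1" "twisted_sign n = 1 \<or> twisted_sign n = -1"
proof -
  show "inv_sign n = 1 \<or> inv_sign n = -1"
    unfolding inv_sign_def by (cases "even (inv2 n)") auto
  then show "twisted_sign n = 1 \<or> twisted_sign n = -1"
    unfolding twisted_sign_def by (cases "even (weight n)") auto
qed

section \<open>Partial sums over blocks of four\<close>

lemma S_Suc: "S (Suc n) = S n + inv_sign (Suc n)"
  by (simp add: S_def)

text \<open>In each block of four the two twisted signs cancel and \<open>inv_sign n\<close> occurs
  twice.\<close>

lemma S_4n_plus_3: "S (4 * n + 3) = 2 * S n"
proof (induction n)
  case 0
  have "S 3 = inv_sign (4 * 0) + inv_sign (4 * 0 + 1) + inv_sign (4 * 0 + 2) + inv_sign (4 * 0 + 3)"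
    by (simp add: S_def eval_nat_numeral)
  also have "\<dots> = 2"
    unfolding signs_quadruple by (simp add: inv_sign_0 twisted_sign_0)
  finally show ?case
    by (simp add: S_def inv_sign_0)
next
  case (Suc n)
  have "S (4 * Suc n + 3) = S (4 * n + 3) + inv_sign (4 * Suc n) + inv_sign (4 * Suc n + 1)
      + inv_sign (4 * Suc n + 2) + inv_sign (4 * Suc n + 3)"
    by (simp add: S_def eval_nat_numeral)
  also have "\<dots> = 2 * S (Suc n)"
    unfolding signs_quadruple Suc S_Suc by simp
  finally show ?case .
qed

lemma S_quadruple:
  "S (4 * n) = 2 * S n - inv_sign n"
  "S (4 * n + 1) = 2 * S n - inv_sign n + twisted_sign n"
  "S (4 * n + 2) = 2 * S n - inv_sign n"
proof -
  \<comment> \<open>Terms are peeled off backwards from the end of the block, where the sum is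
    known.\<close>
  have *: "S (4 * n + 3) = S (4 * n + 2) + inv_sign (4 * n + 3)"
    "S (4 * n + 2) = S (4 * n + 1) + inv_sign (4 * n + 2)"
    "S (4 * n + 1) = S (4 * n) + inv_sign (4 * n + 1)"
    by (simp_all add: S_def eval_nat_numeral)
  show "S (4 * n) = 2 * S n - inv_sign n"
    "S (4 * n + 1) = 2 * S n - inv_sign n + twisted_sign n"
    "S (4 * n + 2) = 2 * S n - inv_sign n"
    using * unfolding signs_quadruple S_4n_plus_3 by simp_all
qed

section \<open>Quadratic bounds on the partial sums\<close>

text \<open>
  In \<open>sum_bounds N s i j\<close> think of \<open>s = S N\<close> and \<open>(i, j)\<close> as the signs at \<open>N\<close>, so that \<open>s - i\<close> is
  the preceding partial sum. The last two clauses exclude equality in the main bounds for the sign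
  pairs with which the induction step would otherwise fail.
\<close>

definition sum_bounds :: "int \<Rightarrow> int \<Rightarrow> int \<Rightarrow> int \<Rightarrow> bool" where
  "sum_bounds N s i j \<longleftrightarrow> 1 \<le> s \<and> i \<le> s \<and>
     s\<^sup>2 \<le> 2 * N + 2 \<and> (s - i)\<^sup>2 \<le> 2 * N \<and> N + 1 \<le> 3 * s\<^sup>2 \<and> N \<le> 3 * (s - i)\<^sup>2 \<and>
     (i = 1 \<and> j = 1 \<longrightarrow> s\<^sup>2 \<le> 2 * N + 1) \<and> (i = 1 \<and> j = -1 \<longrightarrow> N + 1 \<le> 3 * (s - 1)\<^sup>2)"

text \<open>The sharpened clauses are what the step to \<open>4 * N + 1\<close> consumes. For
  \<open>i = j = 1\<close> the new sum is \<open>2 * s\<close>, and its upper bound needs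
  \<open>s\<^sup>2 \<le> 2 * N + 1\<close>. For \<open>i = 1\<close>, \<open>j = -1\<close> it is
  \<open>2 * s - 2\<close>, and its lower bound needs
  \<open>N + 1 \<le> 3 * (s - 1)\<^sup>2\<close>.\<close>

lemma sum_bounds_step:
  assumes "sum_bounds N s i j" and i: "i = 1 \<or> i = -1" and j: "j = 1 \<or> j = -1" and "0 \<le> N"
  shows "sum_bounds (4 * N) (2 * s - i) i j"
    and "sum_bounds (4 * N + 1) (2 * s - i + j) j (- i)"
    and "sum_bounds (4 * N + 2) (2 * s - i) (- j) i"
    and "sum_bounds (4 * N + 3) (2 * s) i j"
proof -
  \<comment> \<open>This keeps the new sum \<open>2 * s - 2\<close> positive; \<open>s = 1\<close>
    would turn the last clause into \<open>N + 1 \<le> 0\<close>.\<close>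
  have "2 \<le> s" if "i = 1" "j = -1"
  proof (rule ccontr)
    assume "\<not> 2 \<le> s"
    with assms(1) have "s = 1"
      by (simp add: sum_bounds_def)
    with that assms(1) \<open>0 \<le> N\<close> show False
      by (simp add: sum_bounds_def)
  qed
  with assms show "sum_bounds (4 * N) (2 * s - i) i j"
    and "sum_bounds (4 * N + 1) (2 * s - i + j) j (- i)"
    and "sum_bounds (4 * N + 2) (2 * s - i) (- j) i"
    and "sum_bounds (4 * N + 3) (2 * s) i j"
    unfolding sum_bounds_def by (auto simp: power2_eq_square algebra_simps)
qed

lemma sum_bounds_S: "sum_bounds (int n) (S n) (inv_sign n) (twisted_sign n)"
proof (induction n rule: less_induct)
  case (less n)
  show ?case
  proof (cases "n = 0")
    case True
    then show ?thesis
      by (simp add: sum_bounds_def S_def inv_sign_0 twisted_sign_0)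
  next
    case False
    define m where "m = n div 4"
    have "m < n"
      using False by (simp add: m_def)
    note step = sum_bounds_step[OF less.IH[OF this] sign_cases of_nat_0_le_iff]
    consider "n = 4 * m" | "n = 4 * m + 1" | "n = 4 * m + 2" | "n = 4 * m + 3"
      unfolding m_def by linarith
    then show ?thesis
    proof cases
      case 1
      show ?thesis
        unfolding 1 S_quadruple signs_quadruple using step(1)
        by (simp only: of_nat_add of_nat_mult of_nat_numeral of_nat_1)
    next
      case 2
      show ?thesis
        unfolding 2 S_quadruple signs_quadruple using step(2)
        by (simp only: of_nat_add of_nat_mult of_nat_numeral of_nat_1)
    next
      case 3
      show ?thesis
        unfolding 3 S_quadruple signs_quadruple using step(3)
        by (simp only: of_nat_add of_nat_mult of_nat_numeral of_nat_1)
    next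
      case 4
      show ?thesis
        unfolding 4 S_4n_plus_3 signs_quadruple using step(4)
        by (simp only: of_nat_add of_nat_mult of_nat_numeral of_nat_1)
    qed
  qed
qed

lemma S_lower: "sqrt 3 / 3 * sqrt (real n) \<le> real_of_int (S n)"
proof -
  have S: "1 \<le> S n" "int n \<le> 3 * (S n)\<^sup>2"
    using sum_bounds_S[of n] by (simp_all add: sum_bounds_def)
  have "real_of_int (int n) \<le> real_of_int (3 * (S n)\<^sup>2)"
    using S(2) by (simp only: of_int_le_iff)
  then have "sqrt (real n / 3) \<le> real_of_int (S n)"
    using S(1) by (intro real_le_lsqrt) auto
  moreover have "sqrt 3 / 3 = 1 / sqrt (3 :: real)"
    by (simp add: field_simps)
  ultimately show ?thesis
    by (simp only: real_sqrt_divide) simp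
qed

lemma S_upper: "real_of_int (S n) \<le> sqrt (2 * real n + 2)"
proof -
  have "(S n)\<^sup>2 \<le> 2 * int n + 2"
    using sum_bounds_S[of n] by (simp add: sum_bounds_def)
  then have "real_of_int ((S n)\<^sup>2) \<le> real_of_int (2 * int n + 2)"
    by (simp only: of_int_le_iff)
  then have "(real_of_int (S n))\<^sup>2 \<le> 2 * real n + 2"
    by simp
  then show ?thesis
    by (rule real_le_rsqrt)
qed

section \<open>Limits along geometric subsequences\<close>

lemma S_four_power: "S (Suc n * 4 ^ k - 1) = 2 ^ k * S n"
proof (induction k)
  case (Suc k)
  \<comment> \<open>Since \<open>4 * m + 3 = 4 * (m + 1) - 1\<close>, each step multiplies the
    successor by 4 and doubles \<open>S\<close>.\<close>
  have "Suc n * 4 ^ Suc k - 1 = 4 * (Suc n * 4 ^ k - 1) + 3"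
    by (simp add: diff_mult_distrib2 del: mult_Suc)
  then show ?case
    using S_4n_plus_3[of "Suc n * 4 ^ k - 1"] Suc by simp
qed simp

text \<open>The factor \<open>2 ^ k\<close> cancels between \<open>S\<close> and the square root,
  leaving only the vanishing term \<open>1 / 4 ^ k\<close>.\<close>

lemma S_ratio_four_power:
  "(\<lambda>k. real_of_int (S (Suc n * 4 ^ k - 1)) / sqrt (real (Suc n * 4 ^ k - 1)))
     \<longlonglongrightarrow> real_of_int (S n) / sqrt (real (Suc n))"
proof -
  have "(\<lambda>k. S n / sqrt (real (Suc n) - 1 / 4 ^ k)) \<longlonglongrightarrow> S n / sqrt (real (Suc n) - 0)"
    by (intro tendsto_intros LIMSEQ_divide_realpow_zero) auto
  moreover have "S n / sqrt (real (Suc n) - 1 / 4 ^ k)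
      = S (Suc n * 4 ^ k - 1) / sqrt (real (Suc n * 4 ^ k - 1))" for k
  proof -
    have "1 \<le> Suc n * 4 ^ k"
      by (simp add: Suc_le_eq del: mult_Suc)
    then have "real (Suc n * 4 ^ k - 1) = 4 ^ k * (real (Suc n) - 1 / 4 ^ k)"
      by (simp add: of_nat_diff algebra_simps del: mult_Suc)
    then have "sqrt (real (Suc n * 4 ^ k - 1)) = 2 ^ k * sqrt (real (Suc n) - 1 / 4 ^ k)"
      using real_sqrt_power[of 4 k] by (simp only: real_sqrt_mult) simp
    then show ?thesis
      unfolding S_four_power by simp
  qed
  ultimately show ?thesis
    by simp
qed

lemma strict_mono_four_power: "strict_mono (\<lambda>k. Suc n * 4 ^ k - 1 :: nat)"
proof (rule strict_monoI_Suc)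
  fix k
  have "0 < Suc n * 4 ^ k"
    by simp
  moreover have "Suc n * 4 ^ Suc k = 4 * (Suc n * 4 ^ k)"
    by simp
  ultimately show "Suc n * 4 ^ k - 1 < Suc n * 4 ^ Suc k - 1"
    by linarith
qed

theorem theorem10:
  shows "liminf (\<lambda>n. ereal (real_of_int (S n) / sqrt (real n))) = ereal (sqrt 3 / 3)
    \<and> limsup (\<lambda>n. ereal (real_of_int (S n) / sqrt (real n))) = ereal (sqrt 2)"
proof -
  let ?f = "\<lambda>n. ereal (real_of_int (S n) / sqrt (real n))"
  let ?r = "\<lambda>n k. Suc n * 4 ^ k - 1"
  have S0: "S 0 = 1"
    by (simp add: S_def inv_sign_0)
  then have S1: "S 1 = 2" and S2: "S 2 = 1"
    using S_quadruple[of 0] by (simp_all add: inv_sign_0 twisted_sign_0 numeral_2_eq_2)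
  have lim: "(?f \<circ> ?r n) \<longlonglongrightarrow> ereal (S n / sqrt (real (Suc n)))" for n
    using S_ratio_four_power[of n] by (simp add: o_def del: mult_Suc)
  \<comment> \<open>Base 2 gives the ratio \<open>S 2 / sqrt 3 = 1 / sqrt 3\<close>.\<close>
  have "liminf ?f \<le> liminf (?f \<circ> ?r 2)"
    by (rule liminf_subseq_mono) (rule strict_mono_four_power)
  also have "\<dots> = ereal (sqrt 3 / 3)"
    using lim_imp_Liminf[OF _ lim, of 2] real_div_sqrt[of 3]
    by (simp add: S2 field_simps del: mult_Suc)
  finally have "liminf ?f \<le> ereal (sqrt 3 / 3)" .
  moreover have "ereal (sqrt 3 / 3) \<le> liminf ?f"
  proof (rule Liminf_bounded)
    show "\<forall>\<^sub>F n in sequentially. ereal (sqrt 3 / 3) \<le> ?f n"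
      \<comment> \<open>At \<open>n = 0\<close> division by zero makes the ratio 0, below the
        bound.\<close>
      using eventually_gt_at_top[of 0]
    proof eventually_elim
      case (elim n)
      then show ?case
        using S_lower[of n] by (simp add: pos_le_divide_eq)
    qed
  qed
  \<comment> \<open>Base 1 gives the ratio \<open>S 1 / sqrt 2 = 2 / sqrt 2\<close>.\<close>
  moreover have "limsup (?f \<circ> ?r 1) \<le> limsup ?f"
    by (rule limsup_subseq_mono) (rule strict_mono_four_power)
  then have "ereal (sqrt 2) \<le> limsup ?f"
    using lim_imp_Limsup[OF _ lim, of 1] real_div_sqrt[of 2]
    by (simp add: S1[simplified] del: mult_Suc)
  moreover have "limsup ?f \<le> limsup (\<lambda>n. ereal (sqrt (2 * real n + 2) / sqrt (real n)))"
    by (intro Limsup_mono always_eventually allI) (simp add: S_upper divide_right_mono)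
  moreover have "(\<lambda>n. sqrt (2 * real n + 2) / sqrt (real n)) \<longlonglongrightarrow> 2 powr (1 / 2)"
    by real_asymp
  then have "limsup (\<lambda>n. ereal (sqrt (2 * real n + 2) / sqrt (real n))) = ereal (sqrt 2)"
    by (intro lim_imp_Limsup) (auto simp: powr_half_sqrt)
  ultimately show ?thesis
    by (metis order.antisym)
qed

end
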